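(* Let $k\ge2$ be an integer, let $T$ be the infinite rooted $k$-ary tree, let $1<p<\infty$ and $$w(x)=\sum_{j=0}^{\infty}k^{(p-1)j}\chi_{T_{j}}(x).$$ Then the estimate $$\|Mf\|_{L^{p}(w)}\lesssim\|f\|_{L^{p}(w)}$$ does not hold (there is no finite constant $C$ with $\|Mf\|_{L^p(w)}\le C\|f\|_{L^p(w)}$ for all $f$), but for every ball $B=B(z,R)$, $z\in T$, $R\in\mathbb{N}\cup\{0\}$, $$\sum_{x\in B}\left(M(\chi_{B}\sigma)(x)\right)^{p}w(x)\lesssim\sum_{x\in B}\sigma(x),$$ where $\sigma=w^{-\frac{1}{p-1}}$ and the implicit constant is independent of $B$.
   Context: For an integer $k\ge2$, $T$ denotes (the vertex set of) the infinite rooted $k$-ary tree, in which every vertex has exactly $k$ children; $d(x,y)$ is the number of edges on the unique path between $x$ and $y$. $T_0$ is the set consisting of the root, and $T_j$ is the set of children of vertices in $T_{j-1}$ for $j\ge1$; $\chi_A$ is the indicator function of $A$. $|A|$ is the cardinality of $A$ and $B(x,r)=\{y\in T: d(x,y)\le r\}$. The centered maximal function is $Mf(x)=\sup_{r\in\mathbb{N}\cup\{0\}}\frac{1}{|B(x,r)|}\sum_{y\in B(x,r)}|f(y)|$. $\|f\|_{L^p(w)}=\left(\sum_{x\in T}|f(x)|^p w(x)\right)^{1/p}$. The notation $A\lesssim B$ means $A\le CB$ for a finite constant $C$. *)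

theory Defs
  imports "HOL-Analysis.Analysis"
begin

text \<open>
  A vertex of the rooted k-ary tree is the list of choices (each below k) leading to it from the
  root, most recent choice first; the root is the empty list.
\<close>

definition tree :: "nat \<Rightarrow> nat list set" where
  "tree k = {x. set x \<subseteq> {..<k}}"

definition children :: "nat \<Rightarrow> nat list \<Rightarrow> nat list set" where
  "children k x = (\<lambda>i. i # x) ` {..<k}"

definition adjacent :: "nat \<Rightarrow> nat list \<Rightarrow> nat list \<Rightarrow> bool" where
  "adjacent k x y \<longleftrightarrow> y \<in> children k x \<or> x \<in> children k y"

definition tree_path :: "nat \<Rightarrow> nat list \<Rightarrow> nat list \<Rightarrow> nat list list \<Rightarrow> bool" where
  "tree_path k x y ps \<longleftrightarrow>
     ps \<noteq> [] \<and> hd ps = x \<and> last ps = y \<and> set ps \<subseteq> tree k \<and> distinct ps \<and>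
     successively (adjacent k) ps"

definition tree_dist :: "nat \<Rightarrow> nat list \<Rightarrow> nat list \<Rightarrow> nat" where
  "tree_dist k x y = length (THE ps. tree_path k x y ps) - 1"

definition tree_ball :: "nat \<Rightarrow> nat list \<Rightarrow> nat \<Rightarrow> nat list set" where
  "tree_ball k x r = {y \<in> tree k. tree_dist k x y \<le> r}"

primrec level :: "nat \<Rightarrow> nat \<Rightarrow> nat list set" where
  "level k 0 = {[]}"
| "level k (Suc j) = (\<Union>x\<in>level k j. children k x)"

definition weight :: "nat \<Rightarrow> real \<Rightarrow> nat list \<Rightarrow> real" where
  "weight k p x = (\<Sum>j. real k powr ((p - 1) * real j) * indicator (level k j) x)"

definition dual_weight :: "nat \<Rightarrow> real \<Rightarrow> nat list \<Rightarrow> real" where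
  "dual_weight k p x = weight k p x powr (- 1 / (p - 1))"

text \<open>
  The maximal function takes values in the extended nonnegative reals because the supremum may be
  infinite for an arbitrary f.
\<close>

definition maximal :: "nat \<Rightarrow> (nat list \<Rightarrow> real) \<Rightarrow> nat list \<Rightarrow> ennreal" where
  "maximal k f x =
     (SUP r::nat. ennreal ((\<Sum>y\<in>tree_ball k x r. \<bar>f y\<bar>) / real (card (tree_ball k x r))))"

text \<open>Powers with a positive real exponent.\<close>

definition epowr :: "ennreal \<Rightarrow> real \<Rightarrow> ennreal" where
  "epowr a q = (if a = top then top else ennreal (enn2real a powr q))"

text \<open>
  The weighted norm, as a functional of the absolute value of a function; it is infinite exactly
  when the function is not in the weighted space.
\<close>

definition wnorm :: "nat \<Rightarrow> real \<Rightarrow> (nat list \<Rightarrow> real) \<Rightarrow> (nat list \<Rightarrow> ennreal) \<Rightarrow> ennreal" where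
  "wnorm k p w g = epowr (\<Sum>\<^sub>\<infinity>x\<in>tree k. epowr (g x) p * ennreal (w x)) (1 / p)"

end

theory Submission
  imports Defs "HOL-Library.Sublist"
begin

text \<open>
  Here \<open>w x = k powr ((p - 1) * length x)\<close>, so \<open>\<sigma> x = 1 / k ^ length x\<close> and
  \<open>\<sigma> powr p * w = \<sigma>\<close>. A ball \<open>B(x, r)\<close> has between \<open>k ^ r\<close> and
  \<open>4 * k ^ r\<close> vertices. Its part hanging below the ancestor of \<open>x\<close> at distance \<open>a\<close> has
  \<open>\<sigma>\<close>-mass at most \<open>(r - a + 1) * k ^ a * \<sigma> x\<close>; summing over \<open>a\<close> gives
  \<open>M \<sigma> \<le> 4 * \<sigma>\<close> pointwise, hence the testing condition for every ball.
  For the indicator \<open>f\<close> of the root, \<open>M f \<ge> \<sigma> / 4\<close>, and \<open>\<sigma> powr p * w = \<sigma>\<close> has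
  mass one on every level, so \<open>M f\<close> has infinite norm while \<open>f\<close> has norm one.
\<close>

section \<open>Paths and distances in the tree\<close>

lemma children_iff: "y \<in> children k x \<longleftrightarrow> (\<exists>i<k. y = i # x)"
  unfolding children_def by auto

lemma tree_Cons [simp]: "i # x \<in> tree k \<longleftrightarrow> i < k \<and> x \<in> tree k"
  unfolding tree_def by auto

lemma tree_append [simp]: "x @ y \<in> tree k \<longleftrightarrow> x \<in> tree k \<and> y \<in> tree k"
  unfolding tree_def by auto

lemma Nil_in_tree [simp]: "[] \<in> tree k"
  unfolding tree_def by auto

text \<open>A vertex is below \<open>x\<close> exactly when it has \<open>x\<close> as a suffix. A
  single edge leaves the subtree below \<open>i # x\<close>, namely the one to \<open>x\<close>, so
  a walk avoiding \<open>x\<close> stays inside.\<close>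

lemma walk_below_child:
  assumes "successively (adjacent k) qs" "qs \<noteq> []" "suffix (i # x) (hd qs)" "x \<notin> set qs"
    and "q \<in> set qs"
  shows "suffix (i # x) q"
  using assms
proof (induction qs)
  case (Cons a qs)
  show ?case
  proof (cases qs)
    case (Cons b qs')
    have "suffix (i # x) b"
      using Cons.prems Cons by (auto simp: adjacent_def children_iff suffix_Cons)
    then show ?thesis using Cons.IH Cons.prems Cons by auto
  qed (use Cons.prems in auto)
qed simp

text \<open>The subtree below \<open>x\<close> can be entered from outside only at its top vertex
  \<open>x\<close>.\<close>

lemma walk_not_below:
  assumes "successively (adjacent k) qs" "qs \<noteq> []" "\<not> suffix x (hd qs)" "x \<notin> set qs"
    and "q \<in> set qs"
  shows "\<not> suffix x q"
  using assms
proof (induction qs)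
  case (Cons a qs)
  show ?case
  proof (cases qs)
    case (Cons b qs')
    have "\<not> suffix x b"
      using Cons.prems Cons by (auto simp: adjacent_def children_iff suffix_Cons)
    then show ?thesis using Cons.IH Cons.prems Cons by auto
  qed (use Cons.prems in auto)
qed simp

text \<open>A path never returns to its start, so its end lies on the side of the first edge that
  was taken. Read backwards, the end vertex dictates the first step: down towards \<open>y\<close>
  if \<open>y\<close> is below \<open>x\<close>, otherwise up to the parent. This is what forces
  uniqueness.\<close>

lemma tree_path_ConsD:
  assumes "tree_path k x y (x # q # qs)"
  shows "tree_path k q y (q # qs)"
    and "(\<exists>i. q = i # x \<and> suffix (i # x) y) \<or> (\<exists>i. x = i # q) \<and> \<not> suffix x y"
proof -
  show "tree_path k q y (q # qs)" using assms unfolding tree_path_def by auto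
  have adj: "adjacent k x q" and walk: "successively (adjacent k) (q # qs)"
    and x: "x \<notin> set (q # qs)" and y: "y \<in> set (q # qs)"
    using assms last_in_set[of "q # qs"] unfolding tree_path_def by auto
  from adj consider i where "q = i # x" | i where "x = i # q"
    unfolding adjacent_def children_iff by auto
  then show "(\<exists>i. q = i # x \<and> suffix (i # x) y) \<or> (\<exists>i. x = i # q) \<and> \<not> suffix x y"
  proof cases
    case 1
    then show ?thesis using walk_below_child[OF walk _ _ x y] by auto
  next
    case 2
    then have "\<not> suffix x q" by (auto dest: suffix_length_le)
    then show ?thesis using walk_not_below[OF walk _ _ x y] 2 by auto
  qed
qed

lemma suffix_child_unique: "suffix (i # x) y \<Longrightarrow> suffix (j # x) y \<Longrightarrow> i = j"
  by (auto simp: suffix_def)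

lemma tree_path_unique:
  assumes "tree_path k x y ps" "tree_path k x y qs"
  shows "ps = qs"
  using assms
proof (induction ps arbitrary: x qs)
  case Nil
  then show ?case unfolding tree_path_def by simp
next
  case (Cons a ps)
  have a: "a = x" using Cons.prems unfolding tree_path_def by simp
  obtain qs' where qs: "qs = x # qs'"
    using Cons.prems(2) unfolding tree_path_def by (cases qs) auto
  \<comment> \<open>A longer path from \<open>x\<close> to \<open>x\<close> would contain
    \<open>x\<close> twice, as head and as last entry.\<close>
  have trivial: "rs = []" if "tree_path k x x (x # rs)" for rs
  proof (rule ccontr)
    assume "rs \<noteq> []"
    then show False using that last_in_set[of rs] unfolding tree_path_def by simp
  qed
  show ?case
  proof (cases "ps = [] \<or> qs' = []")
    case True
    then have "x = y" using Cons.prems unfolding tree_path_def qs a by (elim disjE) simp_all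
    then show ?thesis using trivial[of ps] trivial[of qs'] Cons.prems unfolding qs a by simp
  next
    case False
    then obtain p ps' q qs'' where eq: "ps = p # ps'" "qs' = q # qs''"
      by (meson neq_Nil_conv)
    note P = tree_path_ConsD[OF Cons.prems(1)[unfolded a eq]]
    note Q = tree_path_ConsD[OF Cons.prems(2)[unfolded qs eq]]
    have "p = q"
      using P(2)
    proof (elim disjE exE conjE)
      fix i assume "p = i # x" "suffix (i # x) y"
      then show ?thesis using Q(2) suffix_child_unique[of i x y] suffix_ConsD[of i x y] by blast
    next
      fix i assume "x = i # p" "\<not> suffix x y"
      then show ?thesis using Q(2) suffix_ConsD[of _ x y] by (elim disjE exE conjE) simp_all
    qed
    then show ?thesis using Cons.IH[of p "q # qs''"] P(1) Q(1) unfolding a qs eq by simp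
  qed
qed

text \<open>The clause that all vertices are suffixes of the end is carried along for distinctness:
  a new vertex one level deeper cannot already be on the path.\<close>

lemma tree_path_descend:
  assumes "v @ x \<in> tree k"
  shows "\<exists>ps. tree_path k x (v @ x) ps \<and> length ps = length v + 1 \<and>
    (\<forall>q\<in>set ps. suffix q (v @ x))"
  using assms
proof (induction v)
  case Nil
  then show ?case by (intro exI[of _ "[x]"]) (auto simp: tree_path_def)
next
  case (Cons i v)
  then obtain ps where ps: "tree_path k x (v @ x) ps" "length ps = length v + 1"
    "\<forall>q\<in>set ps. suffix q (v @ x)" by auto
  have "i # v @ x \<notin> set ps" using ps(3) suffix_length_le by fastforce
  then show ?case using ps Cons.prems
    by (intro exI[of _ "ps @ [i # v @ x]"])
       (auto simp: tree_path_def successively_append_iff adjacent_def children_iff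
             intro: suffix_ConsI)
qed

text \<open>If \<open>y\<close> is below \<open>x\<close>, descend; otherwise step to the parent and
  recurse. Here \<open>a\<close> counts the steps up and \<open>drop a x\<close> is the turning
  point. The equation for \<open>y\<close> alone does not determine \<open>a\<close>, hence the
  separate clause for descendants.\<close>

lemma tree_path_exists:
  assumes "x \<in> tree k" "y \<in> tree k"
  shows "\<exists>ps a v. tree_path k x y ps \<and> a \<le> length x \<and> y = v @ drop a x \<and>
    length ps = a + length v + 1 \<and> (suffix x y \<longrightarrow> a = 0) \<and>
    (\<forall>q\<in>set ps. suffix q x \<or> suffix q y)"
  using assms(1)
proof (induction x)
  case Nil
  show ?case using tree_path_descend[of y "[]" k] assms(2) by fastforce
next
  case (Cons i x)
  show ?case
  proof (cases "suffix (i # x) y")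
    case True
    then obtain v where "y = v @ i # x" by (auto simp: suffix_def)
    then show ?thesis using tree_path_descend[of v "i # x" k] assms(2) by fastforce
  next
    case False
    from Cons obtain ps a v where ps: "tree_path k x y ps" "a \<le> length x" "y = v @ drop a x"
      "length ps = a + length v + 1" "\<forall>q\<in>set ps. suffix q x \<or> suffix q y" by auto
    \<comment> \<open>Every vertex of \<open>ps\<close> is an ancestor of \<open>x\<close> or of
      \<open>y\<close> (or equal to one of them), while \<open>i # x\<close> is longer than
      \<open>x\<close> and \<open>y\<close> is not below it.\<close>
    have "i # x \<notin> set ps" using ps(5) False suffix_length_le by fastforce
    then have "tree_path k (i # x) y ((i # x) # ps)"
      using ps(1) Cons.prems by (auto simp: tree_path_def successively_Cons adjacent_def children_iff)
    then show ?thesis using ps False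
      by (intro exI[of _ "(i # x) # ps"] exI[of _ "Suc a"] exI[of _ v])
         (auto intro: suffix_ConsI)
  qed
qed

lemma tree_dist_decomp:
  assumes "x \<in> tree k" "y \<in> tree k"
  obtains a v where "a \<le> length x" "y = v @ drop a x" "tree_dist k x y = a + length v"
    "suffix x y \<Longrightarrow> a = 0"
proof -
  obtain ps a v where ps: "tree_path k x y ps" "a \<le> length x" "y = v @ drop a x"
    "length ps = a + length v + 1" "suffix x y \<longrightarrow> a = 0"
    using tree_path_exists[OF assms] by blast
  have "(THE ps. tree_path k x y ps) = ps"
    using ps(1) tree_path_unique by blast
  then have "tree_dist k x y = a + length v" unfolding tree_dist_def using ps(4) by simp
  then show ?thesis using that ps by blast
qed

section \<open>Levels and explicit forms of the two weights\<close>

lemma level_eq: "level k j = {x \<in> tree k. length x = j}"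
proof (induction j)
  case (Suc j)
  show ?case
  proof (intro set_eqI iffI)
    fix x assume "x \<in> {x \<in> tree k. length x = Suc j}"
    then show "x \<in> level k (Suc j)" using Suc by (cases x) (auto simp: children_iff)
  qed (auto simp: Suc children_iff)
qed auto

lemma finite_level: "finite (level k j)"
  unfolding level_eq tree_def using finite_lists_length_eq[of "{..<k}" j] by (simp add: conj_commute)

lemma card_level: "card (level k j) = k ^ j"
  unfolding level_eq tree_def using card_lists_length_eq[of "{..<k}" j] by simp

lemma weight_eq:
  assumes "x \<in> tree k"
  shows "weight k p x = real k powr ((p - 1) * real (length x))"
proof -
  have "weight k p x = (\<Sum>j\<in>{length x}. real k powr ((p - 1) * real j) * indicator (level k j) x)"
    unfolding weight_def by (rule suminf_finite) (auto simp: level_eq)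
  then show ?thesis using assms by (simp add: level_eq)
qed

lemma dual_weight_eq:
  assumes "x \<in> tree k" "0 < k" "1 < p"
  shows "dual_weight k p x = 1 / real k ^ length x"
proof -
  have "dual_weight k p x = real k powr (- real (length x))"
    unfolding dual_weight_def weight_eq[OF assms(1)] powr_powr using assms by simp
  then show ?thesis using assms by (simp add: powr_minus powr_realpow divide_simps)
qed

section \<open>Size and dual mass of balls, sorted by \<open>a\<close> steps up and \<open>j\<close>
  steps down\<close>

lemma tree_ball_subset_Union:
  assumes "x \<in> tree k"
  shows "tree_ball k x r \<subseteq>
    (\<Union>(a, j)\<in>(SIGMA a:{..min r (length x)}. {..r - a}). (\<lambda>v. v @ drop a x) ` level k j)"
proof
  fix y assume "y \<in> tree_ball k x r"
  then have y: "y \<in> tree k" "tree_dist k x y \<le> r" unfolding tree_ball_def by auto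
  obtain a v where "a \<le> length x" "y = v @ drop a x" "tree_dist k x y = a + length v"
    using tree_dist_decomp[OF assms y(1)] by metis
  with y have "(a, length v) \<in> (SIGMA a:{..min r (length x)}. {..r - a})"
    "v \<in> level k (length v)"
    by (auto simp: level_eq)
  then show "y \<in> (\<Union>(a, j)\<in>(SIGMA a:{..min r (length x)}. {..r - a}).
      (\<lambda>v. v @ drop a x) ` level k j)"
    using \<open>y = v @ drop a x\<close> by blast
qed

lemma finite_tree_ball:
  assumes "x \<in> tree k"
  shows "finite (tree_ball k x r)"
  by (rule finite_subset[OF tree_ball_subset_Union[OF assms]]) (auto simp: finite_level)

text \<open>Subadditivity is the right tool here because the pieces covering a ball overlap: a
  descent from an ancestor of \<open>x\<close> may retrace the climb.\<close>

lemma sum_Union_le: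
  fixes f :: "'a \<Rightarrow> real"
  assumes "finite I" "\<And>i. i \<in> I \<Longrightarrow> finite (A i)" "\<And>x. 0 \<le> f x"
  shows "sum f (\<Union>i\<in>I. A i) \<le> (\<Sum>i\<in>I. sum f (A i))"
  using assms(1,2)
proof (induction I)
  case (insert i I)
  have "sum f (A i \<union> (\<Union>i\<in>I. A i)) \<le> sum f (A i) + sum f (\<Union>i\<in>I. A i)"
    using insert assms(3) by (subst sum_Un) (auto simp: sum_nonneg)
  then show ?case using insert by simp
qed simp

text \<open>Each turning point has at most \<open>k ^ j\<close> descendants \<open>j\<close>
  generations down, all on level \<open>length x - a + j\<close>. The choice \<open>g = 1\<close>
  counts the ball; \<open>g n = 1 / k ^ n\<close> gives its dual mass.\<close>

lemma sum_tree_ball_le: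
  fixes g :: "nat \<Rightarrow> real"
  assumes "x \<in> tree k" "\<And>n. 0 \<le> g n"
  shows "(\<Sum>y\<in>tree_ball k x r. g (length y)) \<le>
    (\<Sum>a\<le>min r (length x). \<Sum>j\<le>r - a. real k ^ j * g (length x - a + j))"
proof -
  let ?I = "SIGMA a:{..min r (length x)}. {..r - a}"
  let ?A = "\<lambda>(a, j). (\<lambda>v. v @ drop a x) ` level k j"
  have "(\<Sum>y\<in>tree_ball k x r. g (length y)) \<le> (\<Sum>y\<in>(\<Union>i\<in>?I. ?A i). g (length y))"
    using tree_ball_subset_Union[OF assms(1), of r] assms(2)
    by (intro sum_mono2) (auto simp: finite_level)
  also have "\<dots> \<le> (\<Sum>i\<in>?I. \<Sum>y\<in>?A i. g (length y))"
    using assms(2) by (intro sum_Union_le) (auto simp: finite_level)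
  also have "\<dots> = (\<Sum>i\<in>?I. case i of (a, j) \<Rightarrow> real k ^ j * g (length x - a + j))"
  proof (intro sum.cong refl, clarify)
    fix a j
    have "(\<Sum>y\<in>(\<lambda>v. v @ drop a x) ` level k j. g (length y)) =
        (\<Sum>v\<in>level k j. g (length x - a + j))"
      by (subst sum.reindex) (auto simp: inj_on_def level_eq add.commute intro!: sum.cong)
    then show "(\<Sum>y\<in>(\<lambda>v. v @ drop a x) ` level k j. g (length y)) =
        real k ^ j * g (length x - a + j)"
      by (simp add: card_level)
  qed
  also have "\<dots> = (\<Sum>a\<le>min r (length x). \<Sum>j\<le>r - a. real k ^ j * g (length x - a + j))"
    by (subst sum.Sigma) auto
  finally show ?thesis .
qed

lemma sum_powers_le:
  assumes "2 \<le> (b::real)"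
  shows "(\<Sum>j\<le>n. b ^ j) \<le> 2 * b ^ n"
proof -
  have "(\<Sum>j\<le>n. b ^ j) + 1 \<le> 2 * b ^ n"
  proof (induction n)
    case (Suc n)
    have "2 * b ^ n \<le> b * b ^ n" using assms by (intro mult_right_mono) auto
    then show ?case using Suc by simp
  qed simp
  then show ?thesis by simp
qed

lemma sum_linear_powers_le:
  assumes "2 \<le> (b::real)"
  shows "(\<Sum>a\<le>r. real (r - a + 1) * b ^ a) \<le> 4 * b ^ r"
proof -
  \<comment> \<open>The bare bound is not inductive, since passing to \<open>Suc r\<close>
    multiplies the sum by \<open>b\<close> and adds \<open>r + 2\<close>. The surplus
    \<open>real r + 3\<close> absorbs this term; for \<open>b = 2\<close> the strengthened
    inequality is an equality.\<close>
  have "(\<Sum>a\<le>r. real (r - a + 1) * b ^ a) + real r + 3 \<le> 4 * b ^ r"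
  proof (induction r)
    case (Suc r)
    let ?S = "\<Sum>a\<le>r. real (r - a + 1) * b ^ a"
    have eq: "(\<Sum>a\<le>Suc r. real (Suc r - a + 1) * b ^ a) = real (r + 2) + b * ?S"
      by (subst sum.atMost_Suc_shift) (simp add: sum_distrib_left mult_ac)
    have "b * (?S + real r + 3) \<le> b * (4 * b ^ r)"
      using Suc assms by (intro mult_left_mono) auto
    moreover have "2 * (real r + 3) \<le> b * (real r + 3)"
      using assms by (intro mult_right_mono) auto
    ultimately show ?case unfolding eq by (simp add: algebra_simps)
  qed simp
  then show ?thesis by simp
qed

text \<open>Two geometric sums, over the descent and then over the climb, each cost a factor
  2.\<close>

lemma card_tree_ball_le:
  assumes "x \<in> tree k" "2 \<le> k"
  shows "real (card (tree_ball k x r)) \<le> 4 * real k ^ r"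
proof -
  have k: "2 \<le> real k" using assms(2) by simp
  have "real (card (tree_ball k x r)) \<le> (\<Sum>a\<le>min r (length x). \<Sum>j\<le>r - a. real k ^ j)"
    using sum_tree_ball_le[OF assms(1), of "\<lambda>_. 1" r] by simp
  also have "\<dots> \<le> (\<Sum>a\<le>min r (length x). 2 * real k ^ (r - a))"
    by (intro sum_mono sum_powers_le k)
  also have "\<dots> \<le> (\<Sum>a\<le>r. 2 * real k ^ (r - a))"
    by (intro sum_mono2) auto
  also have "\<dots> = 2 * (\<Sum>j\<le>r. real k ^ j)"
    using sum.nat_diff_reindex[of "\<lambda>j. real k ^ j" "Suc r"]
    by (simp add: sum_distrib_left[symmetric] lessThan_Suc_atMost)
  also have "\<dots> \<le> 2 * (2 * real k ^ r)"
    by (intro mult_left_mono sum_powers_le k) auto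
  finally show ?thesis by simp
qed

text \<open>The descendants of \<open>x\<close> exactly \<open>r\<close> generations down already
  suffice.\<close>

lemma card_tree_ball_ge:
  assumes "x \<in> tree k"
  shows "real k ^ r \<le> real (card (tree_ball k x r))"
proof -
  have "(\<lambda>v. v @ x) ` level k r \<subseteq> tree_ball k x r"
  proof clarify
    fix v assume v: "v \<in> level k r"
    then have y: "v @ x \<in> tree k" using assms by (auto simp: level_eq)
    obtain a u where u: "v @ x = u @ drop a x" "tree_dist k x (v @ x) = a + length u"
      "suffix x (v @ x) \<Longrightarrow> a = 0"
      using tree_dist_decomp[OF assms y] by metis
    have "a = 0" using u(3) by (simp add: suffix_appendI)
    then have "tree_dist k x (v @ x) = length v" using u(1,2) by simp
    then show "v @ x \<in> tree_ball k x r" using v y by (simp add: tree_ball_def level_eq)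
  qed
  then have "card ((\<lambda>v. v @ x) ` level k r) \<le> card (tree_ball k x r)"
    by (intro card_mono finite_tree_ball assms)
  moreover have "card ((\<lambda>v. v @ x) ` level k r) = k ^ r"
    by (subst card_image) (auto simp: inj_on_def card_level)
  ultimately show ?thesis by (simp flip: of_nat_power)
qed

lemma sum_dual_weight_ball_le:
  assumes "x \<in> tree k" "2 \<le> k" "1 < p"
  shows "(\<Sum>y\<in>tree_ball k x r. dual_weight k p y) \<le> 4 * real k ^ r / real k ^ length x"
proof -
  let ?n = "length x"
  have "(\<Sum>y\<in>tree_ball k x r. dual_weight k p y) = (\<Sum>y\<in>tree_ball k x r. 1 / real k ^ length y)"
    using assms by (intro sum.cong refl dual_weight_eq) (auto simp: tree_ball_def)
  also have "\<dots> \<le> (\<Sum>a\<le>min r ?n. \<Sum>j\<le>r - a. real k ^ j * (1 / real k ^ (?n - a + j)))"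
    using assms(1) by (intro sum_tree_ball_le[where g = "\<lambda>n. 1 / real k ^ n"]) auto
  \<comment> \<open>All generations below one ancestor have the same dual mass: the growth
    \<open>k ^ j\<close> cancels the decay of the weight. The \<open>r - a + 1\<close> admissible
    values of \<open>j\<close> therefore produce the linear factor.\<close>
  also have "\<dots> = (\<Sum>a\<le>min r ?n. real (r - a + 1) * real k ^ a / real k ^ ?n)"
    using assms(2) by (intro sum.cong refl) (auto simp: power_add power_diff)
  also have "\<dots> \<le> (\<Sum>a\<le>r. real (r - a + 1) * real k ^ a / real k ^ ?n)"
    by (intro sum_mono2) auto
  also have "\<dots> = (\<Sum>a\<le>r. real (r - a + 1) * real k ^ a) / real k ^ ?n"
    by (simp add: sum_divide_distrib)
  also have "\<dots> \<le> 4 * real k ^ r / real k ^ ?n"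
    using assms(2) by (intro divide_right_mono sum_linear_powers_le) auto
  finally show ?thesis .
qed

section \<open>The pointwise bound and the testing condition\<close>

lemma maximal_dual_weight_le:
  assumes "x \<in> tree k" "2 \<le> k" "1 < p"
  shows "maximal k (\<lambda>y. indicator B y * dual_weight k p y) x \<le> ennreal (4 * dual_weight k p x)"
  unfolding maximal_def
proof (intro SUP_least ennreal_leI)
  fix r
  let ?B = "tree_ball k x r"
  have pos: "0 < real k ^ r" using assms by simp
  have "(\<Sum>y\<in>?B. \<bar>indicator B y * dual_weight k p y\<bar>) \<le> (\<Sum>y\<in>?B. dual_weight k p y)"
    by (intro sum_mono) (auto simp: dual_weight_def indicator_def)
  \<comment> \<open>Mass and cardinality both scale like \<open>k ^ r\<close>, so the bound on the
    average is independent of the radius.\<close>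
  then have "(\<Sum>y\<in>?B. \<bar>indicator B y * dual_weight k p y\<bar>) / real (card ?B) \<le>
      (4 * real k ^ r / real k ^ length x) / real k ^ r"
    using sum_dual_weight_ball_le[OF assms, of r] card_tree_ball_ge[OF assms(1), of r] pos
    by (intro frac_le) auto
  also have "\<dots> = 4 * dual_weight k p x"
    using dual_weight_eq assms by simp
  finally show "(\<Sum>y\<in>?B. \<bar>indicator B y * dual_weight k p y\<bar>) / real (card ?B) \<le>
      4 * dual_weight k p x" .
qed

lemma epowr_ennreal: "0 \<le> a \<Longrightarrow> epowr (ennreal a) q = ennreal (a powr q)"
  unfolding epowr_def by simp

lemma epowr_mono:
  assumes "a \<le> b" "0 \<le> q"
  shows "epowr a q \<le> epowr b q"
  using assms unfolding epowr_def
  by (auto simp: top_unique less_top enn2real_mono intro!: ennreal_leI powr_mono2)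

text \<open>With \<open>n = length x\<close>, the exponents of \<open>k\<close> add up as
  \<open>- n * p + (p - 1) * n = - n\<close>.\<close>

lemma dual_weight_powr_mult_weight:
  assumes "x \<in> tree k" "0 < k" "1 < p"
  shows "dual_weight k p x powr p * weight k p x = dual_weight k p x"
proof -
  define n where "n = real (length x)"
  have "dual_weight k p x = real k powr (- n)"
    using dual_weight_eq[OF assms] assms(2)
    by (simp add: n_def powr_minus powr_realpow divide_simps)
  then show ?thesis
    unfolding weight_eq[OF assms(1)] n_def[symmetric]
    by (simp add: powr_powr powr_add[symmetric] algebra_simps)
qed

text \<open>The pointwise bound is raised to the power \<open>p\<close> and summed. The set
  \<open>B\<close> is arbitrary, since cutting the dual weight off only lowers the averages; the
  constant \<open>4 powr p\<close> depends on neither \<open>B\<close> nor the ball.\<close>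

lemma testing_condition:
  assumes "z \<in> tree k" "2 \<le> k" "1 < p"
  shows "(\<Sum>x\<in>tree_ball k z R.
      epowr (maximal k (\<lambda>y. indicator B y * dual_weight k p y) x) p * ennreal (weight k p x))
    \<le> ennreal (4 powr p) * ennreal (\<Sum>x\<in>tree_ball k z R. dual_weight k p x)"
proof -
  have nonneg: "0 \<le> dual_weight k p x" for x by (simp add: dual_weight_def)
  have "epowr (maximal k (\<lambda>y. indicator B y * dual_weight k p y) x) p * ennreal (weight k p x)
      \<le> ennreal (4 powr p * dual_weight k p x)" if "x \<in> tree_ball k z R" for x
  proof -
    have x: "x \<in> tree k" using that by (simp add: tree_ball_def)
    have "epowr (maximal k (\<lambda>y. indicator B y * dual_weight k p y) x) p
        \<le> epowr (ennreal (4 * dual_weight k p x)) p"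
      using maximal_dual_weight_le[OF x assms(2,3)] assms(3) by (intro epowr_mono) auto
    also have "\<dots> = ennreal (4 powr p * dual_weight k p x powr p)"
      using nonneg by (simp add: epowr_ennreal powr_mult)
    finally have "epowr (maximal k (\<lambda>y. indicator B y * dual_weight k p y) x) p
        * ennreal (weight k p x)
      \<le> ennreal (4 powr p * dual_weight k p x powr p) * ennreal (weight k p x)"
      by (rule mult_right_mono) simp
    also have "\<dots> = ennreal (4 powr p * (dual_weight k p x powr p * weight k p x))"
      by (simp add: ennreal_mult'[symmetric] weight_eq[OF x] mult.assoc)
    finally show ?thesis using dual_weight_powr_mult_weight[OF x] assms by simp
  qed
  then have "(\<Sum>x\<in>tree_ball k z R.
      epowr (maximal k (\<lambda>y. indicator B y * dual_weight k p y) x) p * ennreal (weight k p x))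
    \<le> (\<Sum>x\<in>tree_ball k z R. ennreal (4 powr p * dual_weight k p x))"
    by (rule sum_mono)
  also have "\<dots> = ennreal (4 powr p) * ennreal (\<Sum>x\<in>tree_ball k z R. dual_weight k p x)"
    using nonneg by (simp add: sum_nonneg ennreal_mult'[symmetric] sum_distrib_left)
  finally show ?thesis .
qed

section \<open>Failure of the norm inequality\<close>

lemma maximal_root_ge:
  assumes "x \<in> tree k" "2 \<le> k" "1 < p"
  shows "ennreal (dual_weight k p x / 4) \<le> maximal k (indicator {[]}) x"
proof -
  \<comment> \<open>With this radius the ball reaches the root, so the average is the reciprocal of
    its cardinality.\<close>
  let ?B = "tree_ball k x (length x)"
  have "tree_dist k x [] \<le> length x"
    using assms(1) Nil_in_tree by (rule tree_dist_decomp) auto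
  then have root: "[] \<in> ?B" unfolding tree_ball_def by simp
  have fin: "finite ?B" using finite_tree_ball[OF assms(1)] .
  have "dual_weight k p x / 4 = 1 / (4 * real k ^ length x)"
    using dual_weight_eq assms by simp
  also have "\<dots> \<le> 1 / real (card ?B)"
    using card_tree_ball_le[OF assms(1,2), of "length x"] root fin
      assms(2)
    by (intro divide_left_mono mult_pos_pos) (auto simp: card_gt_0_iff)
  also have "\<dots> = (\<Sum>y\<in>?B. \<bar>indicator {[]} y\<bar>) / real (card ?B)"
    using fin root by (simp add: indicator_def)
  finally show ?thesis
    unfolding maximal_def by (intro SUP_upper2[of "length x"] ennreal_leI) auto
qed

lemma wnorm_maximal_root:
  assumes "2 \<le> k" "1 < p"
  shows "wnorm k p (weight k p) (maximal k (indicator {[]})) = top"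
proof -
  let ?F = "\<lambda>x. epowr (maximal k (indicator {[]}) x) p * ennreal (weight k p x)"
  define c :: real where "c = (1 / 4) powr p"
  have c: "0 < c" unfolding c_def by simp
  have F: "ennreal (c / real k ^ length x) \<le> ?F x" if x: "x \<in> tree k" for x
  proof -
    have "c / real k ^ length x = c * (dual_weight k p x powr p * weight k p x)"
      using dual_weight_powr_mult_weight[OF x] dual_weight_eq[OF x] assms by simp
    also have "\<dots> = (dual_weight k p x / 4) powr p * weight k p x"
      by (simp add: c_def dual_weight_def powr_divide)
    finally have "ennreal (c / real k ^ length x) =
        epowr (ennreal (dual_weight k p x / 4)) p * ennreal (weight k p x)"
      by (simp add: epowr_ennreal ennreal_mult' weight_eq[OF x] dual_weight_def)
    also have "\<dots> \<le> ?F x"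
      using maximal_root_ge[OF x assms] assms(2) by (intro mult_right_mono epowr_mono) auto
    finally show ?thesis .
  qed
  \<comment> \<open>Level \<open>j\<close> has \<open>k ^ j\<close> vertices, each contributing at
    least \<open>c / k ^ j\<close>. Thus every level adds at least \<open>c\<close>, and the first
    \<open>N\<close> levels add at least \<open>N * c\<close>.\<close>
  have partial_sums: "ennreal (real N * c) \<le> infsum ?F (tree k)" for N
  proof -
    have "(\<Sum>x\<in>level k j. c / real k ^ length x) = c" for j
    proof -
      have "(\<Sum>x\<in>level k j. c / real k ^ length x) = (\<Sum>x\<in>level k j. c / real k ^ j)"
        by (intro sum.cong) (auto simp: level_eq)
      then show ?thesis using assms(1) by (simp add: card_level)
    qed
    then have "real N * c = (\<Sum>j<N. \<Sum>x\<in>level k j. c / real k ^ length x)"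
      by simp
    also have "\<dots> = (\<Sum>x\<in>(\<Union>j<N. level k j). c / real k ^ length x)"
      by (rule sum.UNION_disjoint[symmetric]) (auto simp: finite_level, auto simp: level_eq)
    also have "ennreal \<dots> = (\<Sum>x\<in>(\<Union>j<N. level k j). ennreal (c / real k ^ length x))"
      using c by (intro sum_ennreal[symmetric]) auto
    also have "\<dots> \<le> sum ?F (\<Union>j<N. level k j)"
      by (intro sum_mono F) (auto simp: level_eq)
    \<comment> \<open>For extended nonnegative terms the infinite sum is the supremum of the finite
      partial sums.\<close>
    also have "\<dots> \<le> infsum ?F (tree k)"
      by (subst nonneg_infsum_complete, simp, intro SUP_upper)
         (auto simp: finite_level, auto simp: level_eq)
    finally show ?thesis .
  qed
  have "infsum ?F (tree k) = top"
  proof (rule ccontr)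
    assume "infsum ?F (tree k) \<noteq> top"
    then obtain s where s: "infsum ?F (tree k) = ennreal s" "0 \<le> s"
      by (cases "infsum ?F (tree k)") auto
    obtain N :: nat where "s < real N * c" using reals_Archimedean3[OF c] by blast
    then show False using partial_sums[of N] s by (simp add: ennreal_le_iff)
  qed
  then show ?thesis unfolding wnorm_def by (simp add: epowr_def)
qed

lemma wnorm_root:
  assumes "0 < k"
  shows "wnorm k p (weight k p) (\<lambda>x. ennreal \<bar>indicator {[]} x\<bar>) = 1"
proof -
  have "(\<Sum>\<^sub>\<infinity>x\<in>tree k. epowr (ennreal \<bar>indicator {[]} x\<bar>) p * ennreal (weight k p x)) =
      (\<Sum>\<^sub>\<infinity>x\<in>{[] :: nat list}. 1)"
    using assms by (intro infsum_cong_neutral) (auto simp: epowr_def weight_eq)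
  then show ?thesis unfolding wnorm_def by (simp add: epowr_def)
qed

theorem theorem5p3:
  fixes k :: nat and p :: real
  assumes "k \<ge> 2" and "1 < p"
  shows "\<not> (\<exists>C::real. \<forall>f :: nat list \<Rightarrow> real.
            wnorm k p (weight k p) (maximal k f)
              \<le> ennreal C * wnorm k p (weight k p) (\<lambda>x. ennreal \<bar>f x\<bar>))
       \<and> (\<exists>C::real. \<forall>z\<in>tree k. \<forall>R::nat.
            (\<Sum>x\<in>tree_ball k z R.
               epowr (maximal k (\<lambda>y. indicator (tree_ball k z R) y * dual_weight k p y) x) p
                 * ennreal (weight k p x))
              \<le> ennreal C * ennreal (\<Sum>x\<in>tree_ball k z R. dual_weight k p x))"
proof
  show "\<not> (\<exists>C::real. \<forall>f :: nat list \<Rightarrow> real.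
            wnorm k p (weight k p) (maximal k f)
              \<le> ennreal C * wnorm k p (weight k p) (\<lambda>x. ennreal \<bar>f x\<bar>))"
  proof
    assume "\<exists>C::real. \<forall>f :: nat list \<Rightarrow> real.
            wnorm k p (weight k p) (maximal k f)
              \<le> ennreal C * wnorm k p (weight k p) (\<lambda>x. ennreal \<bar>f x\<bar>)"
    then obtain C where "wnorm k p (weight k p) (maximal k (indicator {[]}))
        \<le> ennreal C * wnorm k p (weight k p) (\<lambda>x. ennreal \<bar>indicator {[]} x\<bar>)"
      by blast
    \<comment> \<open>The right-hand norm is 1, so an infinite quantity would be bounded by the
      finite \<open>ennreal C\<close>.\<close>
    then show False
      using assms wnorm_maximal_root[of k p] wnorm_root[of k p] by (simp add: top_unique)
  qed
  show "\<exists>C::real. \<forall>z\<in>tree k. \<forall>R::nat.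
            (\<Sum>x\<in>tree_ball k z R.
               epowr (maximal k (\<lambda>y. indicator (tree_ball k z R) y * dual_weight k p y) x) p
                 * ennreal (weight k p x))
              \<le> ennreal C * ennreal (\<Sum>x\<in>tree_ball k z R. dual_weight k p x)"
    using testing_condition assms by blast
qed

end
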